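(* Let $A$ be an $\Omega^{(2)}$-algebra over $\Bbbk$ and let $\hat A=A\oplus A'$ be the $\Omega$-algebra with operations $$a\circ_i b=a\vdash_i b+a\dashv_i b,\quad a\circ_i b'=(a\vdash_i b)',\quad a'\circ_i b=(a\dashv_i b)',\quad a'\circ_i b'=0$$ for $a,b\in A$, $i\in I$. Then the following statements are equivalent: (1) $A$ is a di-$\mathrm{Var}$-dendriform algebra; (2) $\hat A$ belongs to $\mathrm{Var}$.
   Context: $\Bbbk$ is an arbitrary field. $\Omega=\{\circ_i\mid i\in I\}$ is a set of binary operation symbols; an $\Omega$-algebra is a $\Bbbk$-linear space with bilinear operations $\circ_i$, $i\in I$. An $\Omega^{(2)}$-algebra is a $\Bbbk$-linear space with bilinear operations $\vdash_i,\dashv_i$, $i\in I$. $\mathrm{Var}$ is the variety of $\Omega$-algebras defined by a family $S$ of poly-linear identities of degrees greater than one: each $f\in S$ of degree $n$ is a $\Bbbk$-linear combination of non-associative $\Omega$-monomials in which each of $x_1,\dots,x_n$ occurs exactly once (in any order and with any bracketing). $A'$ denotes an isomorphic copy of the linear space $A$, with $a\in A$ corresponding to $a'\in A'$. For a poly-linear $\Omega$-monomial $v$, let $v^*$ be the $\Omega^{(2)}$-polynomial obtained by replacing each $\circ_j$ in $v$ with $\vdash_j+\dashv_j$ (and expanding). For a poly-linear $\Omega$-monomial $u$ and an index $k$ such that $x_k$ occurs in $u$, define $\Phi^*(u^{\{k\}})$ recursively: if $u=x_k$, then $\Phi^*(u^{\{k\}})=x_k$; if $u=v\circ_i w$, then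 $\Phi^*(u^{\{k\}})=v^*\vdash_i\Phi^*(w^{\{k\}})$ when $x_k$ occurs in $w$, and $\Phi^*(u^{\{k\}})=\Phi^*(v^{\{k\}})\dashv_i w^*$ when $x_k$ occurs in $v$. Extend linearly to poly-linear $f$. A di-$\mathrm{Var}$-dendriform algebra is an $\Omega^{(2)}$-algebra satisfying the identities $\Phi^*(f^{\{k\}})=0$ for all $f\in S$ and $k=1,\dots,\deg f$. *)

theory Defs
  imports "HOL-Library.Poly_Mapping" "HOL-Analysis.Product_Vector"
begin

section \<open>Non-associative polynomials\<close>

text \<open>Monomials over a signature of binary operation symbols drawn from \<open>'i\<close>; the
  variables are \<open>x\<^sub>1, x\<^sub>2, \<dots>\<close>.\<close>

datatype (ops: 'i) mono = X nat | Op 'i "'i mono" "'i mono"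

fun vars :: "'i mono \<Rightarrow> nat list" where
  "vars (X j) = [j]"
| "vars (Op i v w) = vars v @ vars w"

type_synonym ('k, 'i) na_poly = "'i mono \<Rightarrow>\<^sub>0 'k"

definition polylinear :: "'i set \<Rightarrow> nat \<Rightarrow> ('k::zero, 'i) na_poly \<Rightarrow> bool" where
  "polylinear I n f \<longleftrightarrow>
    (\<forall>u\<in>Poly_Mapping.keys f. ops u \<subseteq> I \<and> distinct (vars u) \<and> set (vars u) = {1..n})"

text \<open>The zero polynomial gets degree 0.\<close>

definition degree :: "('k::zero, 'i) na_poly \<Rightarrow> nat" where
  "degree f = Max (insert 0 ((\<lambda>u. length (vars u)) ` Poly_Mapping.keys f))"

definition smult :: "'k::mult_zero \<Rightarrow> ('k, 'i) na_poly \<Rightarrow> ('k, 'i) na_poly" where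
  "smult c p = Poly_Mapping.map ((*) c) p"

text \<open>The bilinear extension of the operation \<open>Op i\<close> on monomials.\<close>

definition op_poly ::
  "'i \<Rightarrow> ('k::comm_semiring_0, 'i) na_poly \<Rightarrow> ('k, 'i) na_poly \<Rightarrow> ('k, 'i) na_poly" where
  "op_poly i p q = (\<Sum>u\<in>Poly_Mapping.keys p. \<Sum>v\<in>Poly_Mapping.keys q.
     Poly_Mapping.single (Op i u v) (Poly_Mapping.lookup p u * Poly_Mapping.lookup q v))"


section \<open>Algebras and varieties\<close>

locale omega_algebra = vector_space sc
  for sc :: "'k::field \<Rightarrow> 'a::ab_group_add \<Rightarrow> 'a" +
  fixes I :: "'i set" and opn :: "'i \<Rightarrow> 'a \<Rightarrow> 'a \<Rightarrow> 'a"
  assumes linear_right: "i \<in> I \<Longrightarrow> Vector_Spaces.linear sc sc (\<lambda>b. opn i a b)"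
    and linear_left: "i \<in> I \<Longrightarrow> Vector_Spaces.linear sc sc (\<lambda>a. opn i a b)"

primrec eval_mono :: "('i \<Rightarrow> 'a \<Rightarrow> 'a \<Rightarrow> 'a) \<Rightarrow> (nat \<Rightarrow> 'a) \<Rightarrow> 'i mono \<Rightarrow> 'a" where
  "eval_mono opn \<sigma> (X j) = \<sigma> j"
| "eval_mono opn \<sigma> (Op i v w) = opn i (eval_mono opn \<sigma> v) (eval_mono opn \<sigma> w)"

definition eval_poly :: "('k::field \<Rightarrow> 'a::ab_group_add \<Rightarrow> 'a) \<Rightarrow>
    ('i \<Rightarrow> 'a \<Rightarrow> 'a \<Rightarrow> 'a) \<Rightarrow> (nat \<Rightarrow> 'a) \<Rightarrow> ('k, 'i) na_poly \<Rightarrow> 'a" where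
  "eval_poly sc opn \<sigma> f =
    (\<Sum>u\<in>Poly_Mapping.keys f. sc (Poly_Mapping.lookup f u) (eval_mono opn \<sigma> u))"

definition satisfies :: "('k::field \<Rightarrow> 'a::ab_group_add \<Rightarrow> 'a) \<Rightarrow>
    ('i \<Rightarrow> 'a \<Rightarrow> 'a \<Rightarrow> 'a) \<Rightarrow> ('k, 'i) na_poly \<Rightarrow> bool" where
  "satisfies sc opn f \<longleftrightarrow> (\<forall>\<sigma>. eval_poly sc opn \<sigma> f = 0)"

definition in_variety :: "'i set \<Rightarrow> ('k::field, 'i) na_poly set \<Rightarrow>
    ('k \<Rightarrow> 'a::ab_group_add \<Rightarrow> 'a) \<Rightarrow> ('i \<Rightarrow> 'a \<Rightarrow> 'a \<Rightarrow> 'a) \<Rightarrow> bool" where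
  "in_variety I S sc opn \<longleftrightarrow> omega_algebra sc I opn \<and> (\<forall>f\<in>S. satisfies sc opn f)"


section \<open>Di-Var-dendriform algebras\<close>

text \<open>The operation symbols \<open>\<turnstile>\<^sub>i\<close> and \<open>\<stileturn>\<^sub>i\<close>.\<close>

datatype 'i di = Vdash 'i | Dashv 'i

definition di_ops :: "('i \<Rightarrow> 'a \<Rightarrow> 'a \<Rightarrow> 'a) \<Rightarrow> ('i \<Rightarrow> 'a \<Rightarrow> 'a \<Rightarrow> 'a) \<Rightarrow> 'i di \<Rightarrow> 'a \<Rightarrow> 'a \<Rightarrow> 'a" where
  "di_ops vdash dashv = case_di vdash dashv"

definition omega2_algebra :: "('k::field \<Rightarrow> 'a::ab_group_add \<Rightarrow> 'a) \<Rightarrow> 'i set \<Rightarrow>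
    ('i \<Rightarrow> 'a \<Rightarrow> 'a \<Rightarrow> 'a) \<Rightarrow> ('i \<Rightarrow> 'a \<Rightarrow> 'a \<Rightarrow> 'a) \<Rightarrow> bool" where
  "omega2_algebra sc I vdash dashv \<longleftrightarrow>
    omega_algebra sc (Vdash ` I \<union> Dashv ` I) (di_ops vdash dashv)"

primrec star :: "'i mono \<Rightarrow> ('k::field, 'i di) na_poly" where
  "star (X j) = Poly_Mapping.single (X j) 1"
| "star (Op i v w) = op_poly (Vdash i) (star v) (star w) + op_poly (Dashv i) (star v) (star w)"

text \<open>\<open>Phi k u\<close> is meant for multilinear \<open>u\<close> containing the variable \<open>x\<^sub>k\<close>; its values on
  other arguments are irrelevant.\<close>

primrec Phi :: "nat \<Rightarrow> 'i mono \<Rightarrow> ('k::field, 'i di) na_poly" where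
  "Phi k (X j) = Poly_Mapping.single (X j) 1"
| "Phi k (Op i v w) =
    (if k \<in> set (vars w) then op_poly (Vdash i) (star v) (Phi k w)
     else op_poly (Dashv i) (Phi k v) (star w))"

definition Phi_poly :: "nat \<Rightarrow> ('k::field, 'i) na_poly \<Rightarrow> ('k, 'i di) na_poly" where
  "Phi_poly k f = (\<Sum>u\<in>Poly_Mapping.keys f. smult (Poly_Mapping.lookup f u) (Phi k u))"

definition di_var_dendriform :: "'i set \<Rightarrow> ('k::field, 'i) na_poly set \<Rightarrow>
    ('k \<Rightarrow> 'a::ab_group_add \<Rightarrow> 'a) \<Rightarrow> ('i \<Rightarrow> 'a \<Rightarrow> 'a \<Rightarrow> 'a) \<Rightarrow> ('i \<Rightarrow> 'a \<Rightarrow> 'a \<Rightarrow> 'a) \<Rightarrow> bool" where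
  "di_var_dendriform I S sc vdash dashv \<longleftrightarrow>
    omega2_algebra sc I vdash dashv \<and>
    (\<forall>f\<in>S. \<forall>k\<in>{1..degree f}. satisfies sc (di_ops vdash dashv) (Phi_poly k f))"


section \<open>The algebra on \<open>A \<oplus> A'\<close>\<close>

text \<open>\<open>A \<oplus> A'\<close> is the product type with componentwise structure: \<open>(a, a')\<close> stands for the sum of
  an element of \<open>A\<close> and the copy of an element of \<open>A\<close>.\<close>

definition hat_scale :: "('k::field \<Rightarrow> 'a::ab_group_add \<Rightarrow> 'a) \<Rightarrow> 'k \<Rightarrow> 'a \<times> 'a \<Rightarrow> 'a \<times> 'a" where
  "hat_scale sc = module_prod.scale sc sc"

text \<open>The bilinear operation determined by the four rules in \<open>hat_op_rules\<close> below.\<close>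

definition hat_op :: "('i \<Rightarrow> 'a::ab_group_add \<Rightarrow> 'a \<Rightarrow> 'a) \<Rightarrow> ('i \<Rightarrow> 'a \<Rightarrow> 'a \<Rightarrow> 'a) \<Rightarrow>
    'i \<Rightarrow> 'a \<times> 'a \<Rightarrow> 'a \<times> 'a \<Rightarrow> 'a \<times> 'a" where
  "hat_op vdash dashv i x y =
    (vdash i (fst x) (fst y) + dashv i (fst x) (fst y),
     vdash i (fst x) (snd y) + dashv i (snd x) (fst y))"

lemma hat_op_rules:
  assumes "omega2_algebra sc I vdash dashv" and "i \<in> I"
  shows "hat_op vdash dashv i (a, 0) (b, 0) = (vdash i a b + dashv i a b, 0)"
    and "hat_op vdash dashv i (a, 0) (0, b) = (0, vdash i a b)"
    and "hat_op vdash dashv i (0, a) (b, 0) = (0, dashv i a b)"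
    and "hat_op vdash dashv i (0, a) (0, b) = (0, 0)"
proof -
  interpret omega_algebra sc "Vdash ` I \<union> Dashv ` I" "di_ops vdash dashv"
    using assms(1) by (simp add: omega2_algebra_def)
  have R: "di_ops vdash dashv j x 0 = 0" and L: "di_ops vdash dashv j 0 x = 0"
    if "j \<in> {Vdash i, Dashv i}" for j x
  proof -
    have j: "j \<in> Vdash ` I \<union> Dashv ` I" using that assms(2) by auto
    show "di_ops vdash dashv j x 0 = 0"
      using linear_right[OF j, of x] by (rule module_hom.zero[OF module_hom_linearI])
    show "di_ops vdash dashv j 0 x = 0"
      using linear_left[OF j, of x] by (rule module_hom.zero[OF module_hom_linearI])
  qed
  have "vdash i x 0 = 0" "vdash i 0 x = 0" "dashv i x 0 = 0" "dashv i 0 x = 0" for x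
    using R[of "Vdash i" x] R[of "Dashv i" x] L[of "Vdash i" x] L[of "Dashv i" x]
    by (simp_all add: di_ops_def)
  then show "hat_op vdash dashv i (a, 0) (b, 0) = (vdash i a b + dashv i a b, 0)"
    and "hat_op vdash dashv i (a, 0) (0, b) = (0, vdash i a b)"
    and "hat_op vdash dashv i (0, a) (b, 0) = (0, dashv i a b)"
    and "hat_op vdash dashv i (0, a) (0, b) = (0, 0)"
    by (simp_all add: hat_op_def)
qed

end

theory Submission
  imports Defs
begin

text \<open>
  Let \<open>\<sigma>\<close> assign pairs to the variables, with components \<open>a\<close> and \<open>b\<close>. The first component of the
  value of a multilinear monomial \<open>u\<close> in \<open>A \<oplus> A'\<close> is \<open>u\<^sup>*\<close> at \<open>a\<close>, and the second one is the
  sum over the variables \<open>x\<^sub>k\<close> of \<open>u\<close> of \<open>\<Phi>\<^sup>*(u, k)\<close> at \<open>a\<close> with \<open>a\<^sub>k\<close> replaced by \<open>b\<^sub>k\<close>.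
  Moreover \<open>u\<^sup>*\<close> is the sum of all \<open>\<Phi>\<^sup>*(u, k)\<close>. So the identities \<open>\<Phi>\<^sup>*(f, k) = 0\<close>
  make both components of the value of \<open>f\<close> vanish. Conversely, if \<open>b\<^sub>k = a\<^sub>k\<close> and
  \<open>b\<^sub>j = 0\<close> for \<open>j \<noteq> k\<close>, the second component is \<open>\<Phi>\<^sup>*(f, k)\<close> at \<open>a\<close>.
\<close>

section \<open>Coefficients, degrees and linear maps\<close>

lemma lookup_smult:
  "Poly_Mapping.lookup (smult c p) u = c * Poly_Mapping.lookup p u"
  by (simp add: smult_def Poly_Mapping.map.rep_eq when_def)

lemma length_vars_eq:
  assumes "polylinear I n f" "u \<in> Poly_Mapping.keys f"
  shows "length (vars u) = n"
proof -
  have "distinct (vars u)" "set (vars u) = {1..n}"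
    using assms by (auto simp: polylinear_def)
  then show ?thesis
    by (metis distinct_card card_atLeastAtMost diff_Suc_1)
qed

text \<open>The zero polynomial is polylinear for every \<open>n\<close> but has degree 0, so the
  support has to be nonempty.\<close>

lemma degree_polylinear:
  assumes "polylinear I n f" "Poly_Mapping.keys f \<noteq> {}"
  shows "degree f = n"
proof -
  have "(\<lambda>u. length (vars u)) ` Poly_Mapping.keys f = {n}"
    using length_vars_eq[OF assms(1)] assms(2) by (fastforce simp del: keys_eq_empty)
  then show ?thesis by (simp add: degree_def)
qed

lemma linear_iff_additive_homogeneous:
  assumes "vector_space s"
  shows "Vector_Spaces.linear s s f \<longleftrightarrow>
    (\<forall>x y. f (x + y) = f x + f y) \<and> (\<forall>c x. f (s c x) = s c (f x))"
  using assms
  by (auto simp: Vector_Spaces.linear_def module_hom_def module_hom_axioms_def vector_space_def module_def)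

lemma module_prod_scale_apply:
  assumes "vector_space s"
  shows "module_prod.scale s s c x = (s c (fst x), s c (snd x))"
proof -
  interpret vector_space s by fact
  interpret module_prod s s ..
  show ?thesis by (cases x) (simp add: scale_def)
qed

section \<open>Evaluation of polynomials under bilinear operations\<close>

context omega_algebra
begin

lemma opn_sum_left: "i \<in> I \<Longrightarrow> opn i (\<Sum>x\<in>B. g x) b = (\<Sum>x\<in>B. opn i (g x) b)"
  by (rule module_hom.sum[OF module_hom_linearI[OF linear_left]])

lemma opn_sum_right: "i \<in> I \<Longrightarrow> opn i a (\<Sum>x\<in>B. g x) = (\<Sum>x\<in>B. opn i a (g x))"
  by (rule module_hom.sum[OF module_hom_linearI[OF linear_right]])

lemma opn_add_left: "i \<in> I \<Longrightarrow> opn i (a + a') b = opn i a b + opn i a' b"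
  by (rule module_hom.add[OF module_hom_linearI[OF linear_left]])

lemma opn_add_right: "i \<in> I \<Longrightarrow> opn i a (b + b') = opn i a b + opn i a b'"
  by (rule module_hom.add[OF module_hom_linearI[OF linear_right]])

lemma opn_scale_left: "i \<in> I \<Longrightarrow> opn i (sc c a) b = sc c (opn i a b)"
  by (rule module_hom.scale[OF module_hom_linearI[OF linear_left]])

lemma opn_scale_right: "i \<in> I \<Longrightarrow> opn i a (sc c b) = sc c (opn i a b)"
  by (rule module_hom.scale[OF module_hom_linearI[OF linear_right]])

lemma opn_zero_left: "i \<in> I \<Longrightarrow> opn i 0 b = 0"
  by (rule module_hom.zero[OF module_hom_linearI[OF linear_left]])

lemma opn_zero_right: "i \<in> I \<Longrightarrow> opn i a 0 = 0"
  by (rule module_hom.zero[OF module_hom_linearI[OF linear_right]])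

text \<open>Coefficients off the support vanish. Polynomials with different supports can therefore
  be evaluated over one common index set.\<close>

lemma eval_poly_superset:
  assumes "finite K" "Poly_Mapping.keys p \<subseteq> K"
  shows "eval_poly sc opn \<sigma> p = (\<Sum>u\<in>K. sc (Poly_Mapping.lookup p u) (eval_mono opn \<sigma> u))"
  unfolding eval_poly_def
  by (rule sum.mono_neutral_left) (use assms in \<open>auto simp: in_keys_iff\<close>)

lemma eval_poly_zero [simp]: "eval_poly sc opn \<sigma> 0 = 0"
  by (simp add: eval_poly_def)

lemma eval_poly_add:
  "eval_poly sc opn \<sigma> (p + q) = eval_poly sc opn \<sigma> p + eval_poly sc opn \<sigma> q"
proof -
  let ?K = "Poly_Mapping.keys p \<union> Poly_Mapping.keys q"
  have "eval_poly sc opn \<sigma> r = (\<Sum>u\<in>?K. sc (Poly_Mapping.lookup r u) (eval_mono opn \<sigma> u))"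
    if "r \<in> {p, q, p + q}" for r
    using that Poly_Mapping.keys_add[of p q] by (intro eval_poly_superset) auto
  then show ?thesis
    by (simp add: lookup_add scale_left_distrib sum.distrib)
qed

lemma eval_poly_sum:
  "eval_poly sc opn \<sigma> (\<Sum>x\<in>B. g x) = (\<Sum>x\<in>B. eval_poly sc opn \<sigma> (g x))"
  by (induction B rule: infinite_finite_induct) (auto simp: eval_poly_add)

lemma eval_poly_single:
  "eval_poly sc opn \<sigma> (Poly_Mapping.single u c) = sc c (eval_mono opn \<sigma> u)"
  by (subst eval_poly_superset[of "{u}"]) auto

lemma eval_poly_smult:
  "eval_poly sc opn \<sigma> (smult c p) = sc c (eval_poly sc opn \<sigma> p)"
proof -
  have "Poly_Mapping.keys (smult c p) \<subseteq> Poly_Mapping.keys p"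
    by (auto simp: in_keys_iff lookup_smult)
  then show ?thesis
    by (subst eval_poly_superset[of "Poly_Mapping.keys p"])
      (auto simp: lookup_smult eval_poly_def scale_sum_right)
qed

lemma eval_poly_op_poly:
  assumes "i \<in> I"
  shows "eval_poly sc opn \<sigma> (op_poly i p q) =
    opn i (eval_poly sc opn \<sigma> p) (eval_poly sc opn \<sigma> q)"
  unfolding op_poly_def eval_poly_def[of _ _ _ p] eval_poly_def[of _ _ _ q]
  using assms
  \<comment> \<open>Bilinearity turns both sides into the same double sum, but with opposite orders
    of summation.\<close>
  by (simp add: eval_poly_sum eval_poly_single opn_sum_left opn_sum_right opn_scale_left
      opn_scale_right scale_sum_right mult.commute) (rule sum.swap)

end

section \<open>The bilinear operations of the given algebra\<close>

locale di_algebra =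
  fixes sc :: "'k::field \<Rightarrow> 'a::ab_group_add \<Rightarrow> 'a"
    and I :: "'i set"
    and vdash dashv :: "'i \<Rightarrow> 'a \<Rightarrow> 'a \<Rightarrow> 'a"
  assumes omega2: "omega2_algebra sc I vdash dashv"
begin

sublocale omega_algebra sc "Vdash ` I \<union> Dashv ` I" "di_ops vdash dashv"
  using omega2 by (simp add: omega2_algebra_def)

abbreviation di_eval :: "(nat \<Rightarrow> 'a) \<Rightarrow> ('k, 'i di) na_poly \<Rightarrow> 'a" where
  "di_eval \<equiv> eval_poly sc (di_ops vdash dashv)"

abbreviation hat_eval :: "(nat \<Rightarrow> 'a \<times> 'a) \<Rightarrow> 'i mono \<Rightarrow> 'a \<times> 'a" where
  "hat_eval \<equiv> eval_mono (hat_op vdash dashv)"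

lemma vdash_dashv_linear:
  assumes "i \<in> I"
  shows "vdash i (a + a') b = vdash i a b + vdash i a' b"
    and "vdash i a (b + b') = vdash i a b + vdash i a b'"
    and "vdash i (sc c a) b = sc c (vdash i a b)"
    and "vdash i a (sc c b) = sc c (vdash i a b)"
    and "vdash i 0 b = 0" and "vdash i a 0 = 0"
    and "vdash i a (sum g B) = (\<Sum>x\<in>B. vdash i a (g x))"
    and "dashv i (a + a') b = dashv i a b + dashv i a' b"
    and "dashv i a (b + b') = dashv i a b + dashv i a b'"
    and "dashv i (sc c a) b = sc c (dashv i a b)"
    and "dashv i a (sc c b) = sc c (dashv i a b)"
    and "dashv i 0 b = 0" and "dashv i a 0 = 0"
    and "dashv i (sum g B) b = (\<Sum>x\<in>B. dashv i (g x) b)"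
proof -
  have V: "Vdash i \<in> Vdash ` I \<union> Dashv ` I" and D: "Dashv i \<in> Vdash ` I \<union> Dashv ` I"
    using assms by auto
  note rules = opn_add_left opn_add_right opn_scale_left opn_scale_right opn_zero_left
    opn_zero_right opn_sum_left opn_sum_right
  note R = rules[OF V, unfolded di_ops_def di.case] rules[OF D, unfolded di_ops_def di.case]
  show "vdash i (a + a') b = vdash i a b + vdash i a' b"
    "vdash i a (b + b') = vdash i a b + vdash i a b'"
    "vdash i (sc c a) b = sc c (vdash i a b)"
    "vdash i a (sc c b) = sc c (vdash i a b)"
    "vdash i 0 b = 0" "vdash i a 0 = 0"
    "vdash i a (sum g B) = (\<Sum>x\<in>B. vdash i a (g x))"
    "dashv i (a + a') b = dashv i a b + dashv i a' b"
    "dashv i a (b + b') = dashv i a b + dashv i a b'"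
    "dashv i (sc c a) b = sc c (dashv i a b)"
    "dashv i a (sc c b) = sc c (dashv i a b)"
    "dashv i 0 b = 0" "dashv i a 0 = 0"
    "dashv i (sum g B) b = (\<Sum>x\<in>B. dashv i (g x) b)"
    by (fact R)+
qed

lemma di_eval_op_poly:
  assumes "i \<in> I"
  shows "di_eval \<tau> (op_poly (Vdash i) p q) = vdash i (di_eval \<tau> p) (di_eval \<tau> q)"
    and "di_eval \<tau> (op_poly (Dashv i) p q) = dashv i (di_eval \<tau> p) (di_eval \<tau> q)"
proof -
  have "Vdash i \<in> Vdash ` I \<union> Dashv ` I" "Dashv i \<in> Vdash ` I \<union> Dashv ` I"
    using assms by auto
  from this[THEN eval_poly_op_poly]
  show "di_eval \<tau> (op_poly (Vdash i) p q) = vdash i (di_eval \<tau> p) (di_eval \<tau> q)"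
    and "di_eval \<tau> (op_poly (Dashv i) p q) = dashv i (di_eval \<tau> p) (di_eval \<tau> q)"
    by (simp_all add: di_ops_def)
qed

lemma di_eval_Phi_poly:
  "di_eval \<tau> (Phi_poly k f) =
    (\<Sum>u\<in>Poly_Mapping.keys f. sc (Poly_Mapping.lookup f u) (di_eval \<tau> (Phi k u)))"
  by (simp add: Phi_poly_def eval_poly_sum eval_poly_smult)

section \<open>Values of monomials: \<open>star\<close>, \<open>Phi\<close> and the two
  components\<close>

lemma di_eval_star_cong:
  assumes "ops u \<subseteq> I" "\<And>j. j \<in> set (vars u) \<Longrightarrow> \<sigma> j = \<tau> j"
  shows "di_eval \<sigma> (star u) = di_eval \<tau> (star u)"
  using assms by (induction u) (auto simp: eval_poly_single eval_poly_add di_eval_op_poly)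

text \<open>The factor holding the marked variable is always the one that \<open>Phi\<close>
  recurses into, so the zero propagates from the leaf to the root by bilinearity.\<close>

lemma di_eval_Phi_zero:
  assumes "ops u \<subseteq> I" "k \<in> set (vars u)" "\<tau> k = 0"
  shows "di_eval \<tau> (Phi k u) = 0"
  using assms
  by (induction u) (auto simp: eval_poly_single di_eval_op_poly vdash_dashv_linear)

text \<open>The first projection is a homomorphism onto \<open>A\<close> with the operations
  \<open>vdash i + dashv i\<close>, and \<open>star\<close> expands exactly these.\<close>

lemma fst_hat_eval:
  assumes "ops u \<subseteq> I"
  shows "fst (hat_eval \<sigma> u) = di_eval (fst \<circ> \<sigma>) (star u)"
  using assms
  by (induction u) (auto simp: eval_poly_single eval_poly_add di_eval_op_poly hat_op_def)

text \<open>Products of two elements of \<open>A'\<close> vanish, so each surviving term takes its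
  second component from exactly one variable, the marked \<open>x_k\<close>. At every node above
  \<open>x_k\<close> the operation is \<open>vdash\<close> or \<open>dashv\<close> according to the
  side on which \<open>x_k\<close> lies, which is the recursion of \<open>Phi\<close>.\<close>

lemma snd_hat_eval:
  assumes "ops u \<subseteq> I" "distinct (vars u)"
  shows "snd (hat_eval \<sigma> u) =
    (\<Sum>k\<in>set (vars u). di_eval ((fst \<circ> \<sigma>)(k := snd (\<sigma> k))) (Phi k u))"
  using assms
proof (induction u)
  case (X j)
  then show ?case by (simp add: eval_poly_single)
next
  case (Op i v w)
  let ?a = "fst \<circ> \<sigma>"
  let ?upd = "\<lambda>k. ?a(k := snd (\<sigma> k))"
  have i: "i \<in> I" and v: "ops v \<subseteq> I" and w: "ops w \<subseteq> I"
    and disj: "set (vars v) \<inter> set (vars w) = {}"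
    using Op.prems by auto
  \<comment> \<open>By multilinearity the marked variable occurs in one factor only, so the update
    at \<open>k\<close> does not affect \<open>star\<close> of the other factor.\<close>
  have V: "di_eval (?upd k) (Phi k (Op i v w)) =
      dashv i (di_eval (?upd k) (Phi k v)) (di_eval ?a (star w))" if "k \<in> set (vars v)" for k
  proof -
    have "k \<notin> set (vars w)" using that disj by auto
    moreover from this have "di_eval (?upd k) (star w) = di_eval ?a (star w)"
      using w by (intro di_eval_star_cong) auto
    ultimately show ?thesis using i by (simp add: di_eval_op_poly)
  qed
  have W: "di_eval (?upd k) (Phi k (Op i v w)) =
      vdash i (di_eval ?a (star v)) (di_eval (?upd k) (Phi k w))" if "k \<in> set (vars w)" for k
  proof -
    have "k \<notin> set (vars v)" using that disj by auto
    then have "di_eval (?upd k) (star v) = di_eval ?a (star v)"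
      using v by (intro di_eval_star_cong) auto
    then show ?thesis using i that by (simp add: di_eval_op_poly)
  qed
  have "(\<Sum>k\<in>set (vars (Op i v w)). di_eval (?upd k) (Phi k (Op i v w))) =
      (\<Sum>k\<in>set (vars v). di_eval (?upd k) (Phi k (Op i v w))) +
      (\<Sum>k\<in>set (vars w). di_eval (?upd k) (Phi k (Op i v w)))"
    using disj by (simp only: vars.simps set_append sum.union_disjoint finite_set)
  also have "\<dots> = (\<Sum>k\<in>set (vars v). dashv i (di_eval (?upd k) (Phi k v)) (di_eval ?a (star w))) +
      (\<Sum>k\<in>set (vars w). vdash i (di_eval ?a (star v)) (di_eval (?upd k) (Phi k w)))"
    by (intro arg_cong2[where f = "(+)"] sum.cong refl V W)
  \<comment> \<open>The selected facts 7 and 14 move sums out of the right argument of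
    \<open>vdash\<close> and the left argument of \<open>dashv\<close>, the sides carrying the
    mark.\<close>
  also have "\<dots> = dashv i (\<Sum>k\<in>set (vars v). di_eval (?upd k) (Phi k v)) (di_eval ?a (star w)) +
      vdash i (di_eval ?a (star v)) (\<Sum>k\<in>set (vars w). di_eval (?upd k) (Phi k w))"
    by (simp only: vdash_dashv_linear(7,14)[OF i])
  also have "\<dots> = dashv i (snd (hat_eval \<sigma> v)) (di_eval ?a (star w)) +
      vdash i (di_eval ?a (star v)) (snd (hat_eval \<sigma> w))"
    using Op.IH v w Op.prems(2) by (simp only: vars.simps distinct_append)
  also have "\<dots> = snd (hat_eval \<sigma> (Op i v w))"
    using v w by (simp add: hat_op_def fst_hat_eval)
  finally show ?case by (rule sym)
qed

text \<open>On the diagonal the two components of a value in \<open>A \<oplus> A'\<close> agree.\<close>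

lemma di_eval_star_eq_sum_Phi:
  assumes "ops u \<subseteq> I" "distinct (vars u)"
  shows "di_eval \<tau> (star u) = (\<Sum>k\<in>set (vars u). di_eval \<tau> (Phi k u))"
proof -
  let ?\<sigma> = "\<lambda>j. (\<tau> j, \<tau> j)"
  have "snd (hat_eval ?\<sigma> u) = fst (hat_eval ?\<sigma> u)"
    using assms(1)
  proof (induction u)
    case (Op i v w)
    then show ?case by (simp add: hat_op_def)
  qed simp
  then show ?thesis
    using snd_hat_eval[OF assms, of ?\<sigma>] fst_hat_eval[OF assms(1), of ?\<sigma>]
    by (simp add: comp_def fun_upd_idem)
qed

section \<open>Bilinearity and identities of \<open>A \<oplus> A'\<close>\<close>

lemma hat_scale_apply: "hat_scale sc c x = (sc c (fst x), sc c (snd x))"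
  by (simp add: hat_scale_def module_prod_scale_apply vector_space_axioms)

lemma omega_algebra_hat: "omega_algebra (hat_scale sc) I (hat_op vdash dashv)"
proof -
  have vs: "vector_space (hat_scale sc)"
    by unfold_locales (auto simp: hat_scale_apply scale_left_distrib scale_right_distrib)
  show ?thesis
    using vs
    by (auto simp: omega_algebra_def omega_algebra_axioms_def linear_iff_additive_homogeneous
        hat_scale_apply hat_op_def vdash_dashv_linear scale_right_distrib algebra_simps)
qed

text \<open>All monomials of \<open>f\<close> have the same variables, so the sum over monomials can
  be exchanged with the sum over marked variables.\<close>

lemma hat_eval_poly:
  assumes "polylinear I n f"
  shows "eval_poly (hat_scale sc) (hat_op vdash dashv) \<sigma> f =
    (\<Sum>k\<in>{1..n}. di_eval (fst \<circ> \<sigma>) (Phi_poly k f),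
     \<Sum>k\<in>{1..n}. di_eval ((fst \<circ> \<sigma>)(k := snd (\<sigma> k))) (Phi_poly k f))"
proof -
  let ?K = "Poly_Mapping.keys f" and ?c = "Poly_Mapping.lookup f"
  have u: "ops u \<subseteq> I" "distinct (vars u)" "set (vars u) = {1..n}" if "u \<in> ?K" for u
    using assms that by (auto simp: polylinear_def)
  have "eval_poly (hat_scale sc) (hat_op vdash dashv) \<sigma> f =
      (\<Sum>u\<in>?K. sc (?c u) (fst (hat_eval \<sigma> u)), \<Sum>u\<in>?K. sc (?c u) (snd (hat_eval \<sigma> u)))"
    by (simp add: eval_poly_def hat_scale_apply prod_eq_iff fst_sum snd_sum)
  moreover have "(\<Sum>u\<in>?K. sc (?c u) (fst (hat_eval \<sigma> u))) =
      (\<Sum>k\<in>{1..n}. di_eval (fst \<circ> \<sigma>) (Phi_poly k f))"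
    unfolding di_eval_Phi_poly
    by (subst sum.swap)
      (simp add: u fst_hat_eval di_eval_star_eq_sum_Phi scale_sum_right cong: sum.cong)
  moreover have "(\<Sum>u\<in>?K. sc (?c u) (snd (hat_eval \<sigma> u))) =
      (\<Sum>k\<in>{1..n}. di_eval ((fst \<circ> \<sigma>)(k := snd (\<sigma> k))) (Phi_poly k f))"
    unfolding di_eval_Phi_poly
    by (subst sum.swap) (simp add: u snd_hat_eval scale_sum_right cong: sum.cong)
  ultimately show ?thesis by simp
qed

lemma satisfies_hat_iff:
  assumes "polylinear I n f"
  shows "satisfies (hat_scale sc) (hat_op vdash dashv) f \<longleftrightarrow>
    (\<forall>k\<in>{1..n}. satisfies sc (di_ops vdash dashv) (Phi_poly k f))"
proof
  assume "\<forall>k\<in>{1..n}. satisfies sc (di_ops vdash dashv) (Phi_poly k f)"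
  then show "satisfies (hat_scale sc) (hat_op vdash dashv) f"
    by (simp add: satisfies_def hat_eval_poly[OF assms] zero_prod_def)
next
  assume hat: "satisfies (hat_scale sc) (hat_op vdash dashv) f"
  show "\<forall>k\<in>{1..n}. satisfies sc (di_ops vdash dashv) (Phi_poly k f)"
    unfolding satisfies_def
  proof (intro ballI allI)
    fix k and \<tau> :: "nat \<Rightarrow> 'a"
    assume k: "k \<in> {1..n}"
    \<comment> \<open>In the second component the term for \<open>j\<close> is evaluated with
      \<open>x_j\<close> replaced by the second entry at \<open>j\<close>. This entry is 0 for
      \<open>j \<noteq> k\<close>, which kills the term, while for \<open>j = k\<close> the update
      leaves \<open>\<tau>\<close> unchanged.\<close>
    let ?\<sigma> = "\<lambda>j. (\<tau> j, if j = k then \<tau> k else 0)"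
    have zero: "di_eval (\<tau>(j := 0)) (Phi_poly j f) = 0" if "j \<in> {1..n}" for j
    proof -
      have "di_eval (\<tau>(j := 0)) (Phi j u) = 0" if "u \<in> Poly_Mapping.keys f" for u
        using assms that \<open>j \<in> {1..n}\<close> by (intro di_eval_Phi_zero) (auto simp: polylinear_def)
      then show ?thesis by (simp add: di_eval_Phi_poly)
    qed
    have "0 = (\<Sum>j\<in>{1..n}. di_eval (\<tau>(j := if j = k then \<tau> k else 0)) (Phi_poly j f))"
      using hat hat_eval_poly[OF assms, of ?\<sigma>]
      by (simp add: satisfies_def zero_prod_def comp_def)
    also have "\<dots> = (\<Sum>j\<in>{1..n}. if j = k then di_eval \<tau> (Phi_poly k f) else 0)"
      by (rule sum.cong) (auto simp: zero)
    also have "\<dots> = di_eval \<tau> (Phi_poly k f)"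
      using k by simp
    finally show "di_eval \<tau> (Phi_poly k f) = 0" by simp
  qed
qed

lemma satisfies_hat_iff_degree:
  assumes "polylinear I n f"
  shows "satisfies (hat_scale sc) (hat_op vdash dashv) f \<longleftrightarrow>
    (\<forall>k\<in>{1..degree f}. satisfies sc (di_ops vdash dashv) (Phi_poly k f))"
proof (cases "Poly_Mapping.keys f = {}")
  \<comment> \<open>For the zero polynomial \<open>n\<close> need not equal the degree, but both
    sides hold because all sums over the support are empty.\<close>
  case True
  then show ?thesis by (simp add: satisfies_def eval_poly_def[of "hat_scale sc"] di_eval_Phi_poly)
next
  case False
  then show ?thesis using satisfies_hat_iff[OF assms] degree_polylinear[OF assms] by simp
qed

end

theorem theorem2:
  fixes I :: "'i set"
    and S :: "('k::field, 'i) na_poly set"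
    and sc :: "'k \<Rightarrow> 'a::ab_group_add \<Rightarrow> 'a"
    and vdash dashv :: "'i \<Rightarrow> 'a \<Rightarrow> 'a \<Rightarrow> 'a"
  assumes "\<forall>f\<in>S. \<exists>n>1. polylinear I n f"
    and "omega2_algebra sc I vdash dashv"
  shows "di_var_dendriform I S sc vdash dashv \<longleftrightarrow>
    in_variety I S (hat_scale sc) (hat_op vdash dashv)"
proof -
  interpret di_algebra sc I vdash dashv
    using assms(2) by unfold_locales
  \<comment> \<open>Both algebras have bilinear operations, so the claim reduces to comparing the
    identities for each \<open>f \<in> S\<close> separately.\<close>
  show ?thesis
    using assms omega_algebra_hat satisfies_hat_iff_degree
    unfolding di_var_dendriform_def in_variety_def by blast
qed

end
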